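(* Suppose that $f\equiv0$ and let the discrete initial value be $U_{0,h}=\{u_{0,h},u_{1,h}\}\in V_h^2$. Then the fully discrete solution $U_{\tau,h}=\{u^0_{\tau,h},u^1_{\tau,h}\}$ and the lifted fully discrete solution $L_\tau U_{\tau,h}=\{L_\tau u^0_{\tau,h},L_\tau u^1_{\tau,h}\}$ satisfy the energy conservation property $$\langle v^1_{\tau,h}(t_n),v^1_{\tau,h}(t_n)\rangle+\langle\nabla v^0_{\tau,h}(t_n),\nabla v^0_{\tau,h}(t_n)\rangle=\langle u_{1,h},u_{1,h}\rangle+\langle\nabla u_{0,h},\nabla u_{0,h}\rangle$$ for all $n=1,\dots,N$, for $\{v^0_{\tau,h},v^1_{\tau,h}\}=\{u^0_{\tau,h},u^1_{\tau,h}\}$ as well as for $\{v^0_{\tau,h},v^1_{\tau,h}\}=\{L_\tau u^0_{\tau,h},L_\tau u^1_{\tau,h}\}$.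
   Context: $\Omega\subset\mathbb R^d$, $d\in\{2,3\}$, is a bounded polygonal or polyhedral domain, $T>0$, $\bar I=[0,T]$; $\langle\cdot,\cdot\rangle$ is the $L^2(\Omega)$ inner product and $\langle\!\langle\cdot,\cdot\rangle\!\rangle$ that of $(L^2(\Omega))^2$. $F=\{0,f\}$. Time discretization, $k\ge1$: $0=t_0<\dots<t_N=T$, $I_n=(t_{n-1},t_n]$, $\tau_n=t_n-t_{n-1}$. $\mathbb P_k(I_n;B)$ is the space of polynomials in $t$ of degree at most $k$ with coefficients in $B$; $X_\tau^k(B)=\{w\in C(\bar I;B):w|_{I_n}\in\mathbb P_k(I_n;B)\ \forall n\}$. Values (also of derivatives) of $w|_{I_n}$ at the endpoints of $I_n$ are one-sided limits from the interior of $I_n$. $t_{n-1}=t_{n,0}<\dots<t_{n,k}=t_n$ are the $(k+1)$ Gauss–Lobatto points on $\bar I_n$ and $Q_n(g)=\frac{\tau_n}{2}\sum_{\mu=0}^k\hat\omega_\mu\, g|_{I_n}(t_{n,\mu})$ is the Gauss–Lobatto formula. Space discretization: $\mathcal T_h$ is a shape-regular quadrilateral/hexahedral mesh of $\Omega$, $V_h=\{v_h\in C(\bar\Omega):v_h|_K\in\mathbb Q_r(K)\ \forall K\in\mathcal T_h\}\cap H^1_0(\Omega)$ ($\mathbb Q_r(K)$: mapped polynomials of degree at most $r$ in each variable). $\mathcal P_h$ is the componentwise $L^2$-projection onto $V_h^2$. $A_h:H_0^1(\Omega)\to V_h$, $\langle A_hw,v_h\rangle=\langle\nabla w,\nabla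 v_h\rangle$ for all $v_h\in V_h$; $\mathcal A_h\{w^0,w^1\}:=\{-w^1,A_hw^0\}$. Fully discrete solution: $U_{\tau,h}\in(X^k_\tau(V_h))^2$ with $U_{\tau,h}(0)=U_{0,h}$ and, for $n=1,\dots,N$, $$\int_{I_n}\big(\langle\!\langle\partial_tU_{\tau,h},V_{\tau,h}\rangle\!\rangle+\langle\!\langle\mathcal A_hU_{\tau,h},V_{\tau,h}\rangle\!\rangle\big)\,dt=Q_n(\langle\!\langle F,V_{\tau,h}\rangle\!\rangle)\quad\forall V_{\tau,h}\in(\mathbb P_{k-1}(I_n;V_h))^2.$$ Lifting: $\vartheta_n\in\mathbb P_{k+1}(\bar I_n;\mathbb R)$ satisfies $\vartheta_n(t_{n,\mu})=0$ for $\mu=0,\dots,k$ and $\vartheta_n'(t_{n-1})=1$. Componentwise, $L_\tau U_{\tau,h}(0)=U_{\tau,h}(0)$, $L_\tau U_{\tau,h}(t)=U_{\tau,h}(t)-c_{n-1}\vartheta_n(t)$ for $t\in I_n$, where $\partial_tL_\tau U_{\tau,h}(0):=\mathcal P_hF(0)-\mathcal A_hU_{0,h}$, $c_0=\partial_tU_{\tau,h}|_{I_1}(0)-\partial_tL_\tau U_{\tau,h}(0)$ and $c_{n-1}=\partial_tU_{\tau,h}|_{I_n}(t_{n-1})-\partial_tL_\tau U_{\tau,h}|_{I_{n-1}}(t_{n-1})$ for $n>1$. *)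

theory Defs
  imports "HOL-Analysis.Analysis"
begin

section \<open>Domain, \<open>L\<^sup>2\<close> and \<open>H\<^sup>1\<^sub>0\<close>\<close>

type_synonym 'd sfun = "(real, 'd) vec \<Rightarrow> real"

definition polyhedral_domain :: "(real ^ 'd) set \<Rightarrow> bool" where
  "polyhedral_domain \<Omega> \<longleftrightarrow>
     open \<Omega> \<and> connected \<Omega> \<and> bounded \<Omega> \<and> \<Omega> \<noteq> {} \<and>
     (\<exists>\<P>. finite \<P> \<and> (\<forall>P\<in>\<P>. polytope P \<and> aff_dim P = int CARD('d) - 1) \<and>
          frontier \<Omega> = \<Union>\<P>)"

definition square_integrable :: "(real ^ 'd) set \<Rightarrow> (real ^ 'd \<Rightarrow> 'b::euclidean_space) \<Rightarrow> bool" where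
  "square_integrable \<Omega> u \<longleftrightarrow>
     set_borel_measurable lebesgue \<Omega> u \<and> set_integrable lebesgue \<Omega> (\<lambda>x. (norm (u x))\<^sup>2)"

text \<open>Used for scalar functions and for (gradient) vector fields alike.\<close>

definition l2_inner :: "(real ^ 'd) set \<Rightarrow> (real ^ 'd \<Rightarrow> 'b::euclidean_space) \<Rightarrow> (real ^ 'd \<Rightarrow> 'b) \<Rightarrow> real" where
  "l2_inner \<Omega> u v = (LINT x:\<Omega>|lebesgue. u x \<bullet> v x)"

definition l2_norm :: "(real ^ 'd) set \<Rightarrow> (real ^ 'd \<Rightarrow> 'b::euclidean_space) \<Rightarrow> real" where
  "l2_norm \<Omega> u = sqrt (l2_inner \<Omega> u u)"

definition l2_inner2 ::
  "(real ^ 'd) set \<Rightarrow> 'd sfun \<times> 'd sfun \<Rightarrow> 'd sfun \<times> 'd sfun \<Rightarrow> real" where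
  "l2_inner2 \<Omega> W V = l2_inner \<Omega> (fst W) (fst V) + l2_inner \<Omega> (snd W) (snd V)"

definition classical_grad :: "'d::finite sfun \<Rightarrow> real ^ 'd \<Rightarrow> real ^ 'd" where
  "classical_grad \<phi> x = (THE D. GDERIV \<phi> x :> D)"

primrec Ck :: "nat \<Rightarrow> 'd::finite sfun \<Rightarrow> bool" where
  "Ck 0 \<phi> \<longleftrightarrow> continuous_on UNIV \<phi>"
| "Ck (Suc m) \<phi> \<longleftrightarrow> (\<exists>g. (\<forall>x. GDERIV \<phi> x :> g x) \<and> (\<forall>i. Ck m (\<lambda>x. g x $ i)))"

text \<open>\<open>C\<^sub>c\<^sup>\<infinity>(\<Omega>)\<close>, with functions extended by zero to the whole space.\<close>

definition test_functions :: "(real ^ 'd) set \<Rightarrow> 'd sfun set" where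
  "test_functions \<Omega> =
     {\<phi>. (\<forall>m. Ck m \<phi>) \<and> compact (closure {x. \<phi> x \<noteq> 0}) \<and> closure {x. \<phi> x \<noteq> 0} \<subseteq> \<Omega>}"

definition has_weak_grad :: "(real ^ 'd) set \<Rightarrow> 'd sfun \<Rightarrow> (real ^ 'd \<Rightarrow> real ^ 'd) \<Rightarrow> bool" where
  "has_weak_grad \<Omega> u g \<longleftrightarrow>
     square_integrable \<Omega> u \<and> square_integrable \<Omega> g \<and>
     (\<forall>\<phi>\<in>test_functions \<Omega>.
        (LINT x:\<Omega>|lebesgue. u x *\<^sub>R classical_grad \<phi> x) = - (LINT x:\<Omega>|lebesgue. \<phi> x *\<^sub>R g x))"

text \<open>Weak gradients are unique only up to null sets; a representative is chosen.\<close>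

definition weak_grad :: "(real ^ 'd) set \<Rightarrow> 'd sfun \<Rightarrow> real ^ 'd \<Rightarrow> real ^ 'd" where
  "weak_grad \<Omega> u = (SOME g. has_weak_grad \<Omega> u g)"

text \<open>The closure of \<open>C\<^sub>c\<^sup>\<infinity>(\<Omega>)\<close> in the \<open>H\<^sup>1(\<Omega>)\<close>-norm.\<close>

definition H10 :: "(real ^ 'd) set \<Rightarrow> 'd sfun set" where
  "H10 \<Omega> = {u. \<exists>g. has_weak_grad \<Omega> u g \<and>
      (\<exists>\<phi>. (\<forall>m::nat. \<phi> m \<in> test_functions \<Omega>) \<and>
         (\<lambda>m. l2_norm \<Omega> (\<lambda>x. \<phi> m x - u x)) \<longlonglongrightarrow> 0 \<and>
         (\<lambda>m. l2_norm \<Omega> (\<lambda>x. classical_grad (\<phi> m) x - g x)) \<longlonglongrightarrow> 0)}"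


section \<open>Finite element space\<close>

definition Qr :: "nat \<Rightarrow> 'd::finite sfun set" where
  "Qr r = {p. \<exists>c :: ('d \<Rightarrow> nat) \<Rightarrow> real. \<forall>x.
       p x = (\<Sum>\<alpha> \<in> {\<alpha>. \<forall>i. \<alpha> i \<le> r}. c \<alpha> * (\<Prod>i\<in>UNIV. (x $ i) ^ \<alpha> i))}"

abbreviation ref_cell :: "(real ^ 'd) set" where
  "ref_cell \<equiv> cbox 0 1"

text \<open>A mesh is a finite set \<open>\<T>\<close> of closed cells together with, for every cell \<open>K\<close>, its
  \<open>d\<close>-linear reference map \<open>\<Phi> K\<close> from the unit cube onto \<open>K\<close>. Cells have disjoint interiors;
  face-to-face conformity is not imposed, so hanging nodes are admitted.\<close>

definition quad_hex_mesh ::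
  "(real ^ 'd) set \<Rightarrow> (real ^ 'd) set set \<Rightarrow> ((real ^ 'd) set \<Rightarrow> real ^ 'd \<Rightarrow> real ^ 'd) \<Rightarrow> bool" where
  "quad_hex_mesh \<Omega> \<T> \<Phi> \<longleftrightarrow>
     finite \<T> \<and> \<Union>\<T> = closure \<Omega> \<and>
     (\<forall>K\<in>\<T>. (\<forall>i. (\<lambda>\<xi>. \<Phi> K \<xi> $ i) \<in> Qr 1) \<and> inj_on (\<Phi> K) ref_cell \<and> \<Phi> K ` ref_cell = K) \<and>
     (\<forall>K\<in>\<T>. \<forall>L\<in>\<T>. K \<noteq> L \<longrightarrow> interior K \<inter> interior L = {})"

text \<open>With \<open>h = diam K\<close>, this is \<open>\<parallel>D\<Phi>\<^sub>K\<parallel> \<le> \<sigma> h\<close> and \<open>\<parallel>D\<Phi>\<^sub>K\<^sup>-\<^sup>1\<parallel> \<le> \<sigma> / h\<close> on the unit cube.\<close>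

definition shape_regular ::
  "real \<Rightarrow> (real ^ 'd) set set \<Rightarrow> ((real ^ 'd) set \<Rightarrow> real ^ 'd \<Rightarrow> real ^ 'd) \<Rightarrow> bool" where
  "shape_regular \<sigma> \<T> \<Phi> \<longleftrightarrow> \<sigma> > 0 \<and>
     (\<forall>K\<in>\<T>. \<forall>\<xi>\<in>ref_cell. \<forall>v.
        norm (frechet_derivative (\<Phi> K) (at \<xi>) v) \<le> \<sigma> * diameter K * norm v \<and>
        diameter K * norm v \<le> \<sigma> * norm (frechet_derivative (\<Phi> K) (at \<xi>) v))"

text \<open>Functions on the closure of \<open>\<Omega>\<close> are represented by their extension by zero. The second
  condition says that \<open>v\<close> restricted to \<open>K\<close> is a mapped polynomial \<open>p \<circ> (\<Phi> K)\<^sup>-\<^sup>1\<close>.\<close>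

definition fe_space ::
  "(real ^ 'd) set \<Rightarrow> (real ^ 'd) set set \<Rightarrow> ((real ^ 'd) set \<Rightarrow> real ^ 'd \<Rightarrow> real ^ 'd) \<Rightarrow> nat
     \<Rightarrow> 'd sfun set" where
  "fe_space \<Omega> \<T> \<Phi> r =
     {v. continuous_on (closure \<Omega>) v \<and>
         (\<forall>K\<in>\<T>. \<exists>p\<in>Qr r. \<forall>\<xi>\<in>ref_cell. v (\<Phi> K \<xi>) = p \<xi>) \<and>
         v \<in> H10 \<Omega> \<and>
         (\<forall>x. x \<notin> closure \<Omega> \<longrightarrow> v x = 0)}"

text \<open>\<open>P\<close> is the scalar \<open>L\<^sup>2\<close>-projection onto \<open>V\<close>, and \<open>A\<close> is the discrete Laplacian
  \<open>A\<^sub>h\<close>; each is uniquely determined (on \<open>L\<^sup>2\<close>, respectively on \<open>H\<^sup>1\<^sub>0\<close>) by its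
  defining property.\<close>

definition is_l2_projection ::
  "(real ^ 'd) set \<Rightarrow> 'd sfun set \<Rightarrow> ('d sfun \<Rightarrow> 'd sfun) \<Rightarrow> bool" where
  "is_l2_projection \<Omega> V P \<longleftrightarrow>
     (\<forall>w. square_integrable \<Omega> w \<longrightarrow> P w \<in> V \<and> (\<forall>v\<in>V. l2_inner \<Omega> (P w) v = l2_inner \<Omega> w v))"

definition is_discrete_laplacian ::
  "(real ^ 'd) set \<Rightarrow> 'd sfun set \<Rightarrow> ('d sfun \<Rightarrow> 'd sfun) \<Rightarrow> bool" where
  "is_discrete_laplacian \<Omega> V A \<longleftrightarrow>
     (\<forall>w\<in>H10 \<Omega>. A w \<in> V \<and>
        (\<forall>v\<in>V. l2_inner \<Omega> (A w) v = l2_inner \<Omega> (weak_grad \<Omega> w) (weak_grad \<Omega> v)))"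

definition proj2 :: "('d sfun \<Rightarrow> 'd sfun) \<Rightarrow> 'd sfun \<times> 'd sfun \<Rightarrow> 'd sfun \<times> 'd sfun" where
  "proj2 P W = (P (fst W), P (snd W))"

definition wave_op :: "('d sfun \<Rightarrow> 'd sfun) \<Rightarrow> 'd sfun \<times> 'd sfun \<Rightarrow> 'd sfun \<times> 'd sfun" where
  "wave_op A W = (- snd W, A (fst W))"

definition source :: "(real \<Rightarrow> 'd sfun) \<Rightarrow> real \<Rightarrow> 'd sfun \<times> 'd sfun" where
  "source f s = ((\<lambda>x. 0), f s)"


section \<open>Time discretization\<close>

definition time_mesh :: "(nat \<Rightarrow> real) \<Rightarrow> nat \<Rightarrow> real \<Rightarrow> bool" where
  "time_mesh t N T \<longleftrightarrow> t 0 = 0 \<and> t N = T \<and> (\<forall>n\<in>{1..N}. t (n - 1) < t n)"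

abbreviation subinterval :: "(nat \<Rightarrow> real) \<Rightarrow> nat \<Rightarrow> real set" where
  "subinterval t n \<equiv> {t (n - 1)<..t n}"

text \<open>The value at \<open>s\<close> in the closed \<open>n\<close>-th subinterval of the restriction of \<open>g\<close> to it; at
  the two endpoints this is the one-sided limit from the interior.\<close>

definition local_val :: "(nat \<Rightarrow> real) \<Rightarrow> nat \<Rightarrow> (real \<Rightarrow> real) \<Rightarrow> real \<Rightarrow> real" where
  "local_val t n g s =
     (if t (n - 1) < s \<and> s < t n then g s else Lim (at s within {t (n - 1)<..<t n}) g)"

definition local_dt :: "(nat \<Rightarrow> real) \<Rightarrow> nat \<Rightarrow> (real \<Rightarrow> 'd sfun) \<Rightarrow> real \<Rightarrow> 'd sfun" where
  "local_dt t n w s = (\<lambda>x. local_val t n (deriv (\<lambda>r. w r x)) s)"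

definition local_dt2 ::
  "(nat \<Rightarrow> real) \<Rightarrow> nat \<Rightarrow> (real \<Rightarrow> 'd sfun \<times> 'd sfun) \<Rightarrow> real \<Rightarrow> 'd sfun \<times> 'd sfun" where
  "local_dt2 t n W s = (local_dt t n (\<lambda>r. fst (W r)) s, local_dt t n (\<lambda>r. snd (W r)) s)"

text \<open>\<open>\<P>\<^sub>k(I;B)\<close>, as a condition on the restriction of \<open>w\<close> to \<open>I\<close>.\<close>

definition Pk :: "nat \<Rightarrow> real set \<Rightarrow> 'd sfun set \<Rightarrow> (real \<Rightarrow> 'd sfun) set" where
  "Pk k I B = {w. \<exists>c. (\<forall>j\<le>k. c j \<in> B) \<and> (\<forall>s\<in>I. \<forall>x. w s x = (\<Sum>j\<le>k. s ^ j * c j x))}"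

text \<open>\<open>X\<^sub>\<tau>\<^sup>k(B)\<close>, where \<open>B\<close> carries the \<open>L\<^sup>2\<close>-norm.\<close>

definition Xk ::
  "(real ^ 'd) set \<Rightarrow> (nat \<Rightarrow> real) \<Rightarrow> nat \<Rightarrow> nat \<Rightarrow> 'd sfun set \<Rightarrow> (real \<Rightarrow> 'd sfun) set" where
  "Xk \<Omega> t N k B =
     {w. (\<forall>s\<in>{t 0..t N}. w s \<in> B \<and>
            ((\<lambda>r. l2_norm \<Omega> (\<lambda>x. w r x - w s x)) \<longlongrightarrow> 0) (at s within {t 0..t N})) \<and>
         (\<forall>n\<in>{1..N}. w \<in> Pk k (subinterval t n) B)}"

text \<open>The \<open>(k+1)\<close>-point Gauss-Lobatto rule on \<open>[-1,1]\<close>: both endpoints are nodes, and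
  the rule has the maximal degree of exactness \<open>2k-1\<close>, which determines nodes and weights.\<close>

definition gauss_lobatto :: "nat \<Rightarrow> (nat \<Rightarrow> real) \<Rightarrow> (nat \<Rightarrow> real) \<Rightarrow> bool" where
  "gauss_lobatto k \<xi> \<omega> \<longleftrightarrow>
     \<xi> 0 = -1 \<and> \<xi> k = 1 \<and> (\<forall>\<mu><k. \<xi> \<mu> < \<xi> (Suc \<mu>)) \<and>
     (\<forall>p :: real poly. degree p \<le> 2 * k - 1 \<longrightarrow>
        (\<Sum>\<mu>\<le>k. \<omega> \<mu> * poly p (\<xi> \<mu>)) = integral {-1..1} (poly p))"

definition gl_node :: "(nat \<Rightarrow> real) \<Rightarrow> (nat \<Rightarrow> real) \<Rightarrow> nat \<Rightarrow> nat \<Rightarrow> real" where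
  "gl_node t \<xi> n \<mu> = (t (n - 1) + t n) / 2 + (t n - t (n - 1)) / 2 * \<xi> \<mu>"

definition gl_quad ::
  "(nat \<Rightarrow> real) \<Rightarrow> nat \<Rightarrow> (nat \<Rightarrow> real) \<Rightarrow> (nat \<Rightarrow> real) \<Rightarrow> nat \<Rightarrow> (real \<Rightarrow> real) \<Rightarrow> real" where
  "gl_quad t k \<xi> \<omega> n g =
     (t n - t (n - 1)) / 2 * (\<Sum>\<mu>\<le>k. \<omega> \<mu> * local_val t n g (gl_node t \<xi> n \<mu>))"


section \<open>Fully discrete solution and its lifting\<close>

definition fully_discrete_solution ::
  "(real ^ 'd) set \<Rightarrow> 'd sfun set \<Rightarrow> ('d sfun \<Rightarrow> 'd sfun) \<Rightarrow> (nat \<Rightarrow> real) \<Rightarrow> nat \<Rightarrow> nat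
     \<Rightarrow> (nat \<Rightarrow> real) \<Rightarrow> (nat \<Rightarrow> real) \<Rightarrow> (real \<Rightarrow> 'd sfun) \<Rightarrow> 'd sfun \<times> 'd sfun
     \<Rightarrow> (real \<Rightarrow> 'd sfun \<times> 'd sfun) \<Rightarrow> bool" where
  "fully_discrete_solution \<Omega> Vh A t N k \<xi> \<omega> f U0 U \<longleftrightarrow>
     (\<lambda>s. fst (U s)) \<in> Xk \<Omega> t N k Vh \<and> (\<lambda>s. snd (U s)) \<in> Xk \<Omega> t N k Vh \<and>
     U 0 = U0 \<and>
     (\<forall>n\<in>{1..N}. \<forall>V.
        (\<lambda>s. fst (V s)) \<in> Pk (k - 1) (subinterval t n) Vh \<and>
        (\<lambda>s. snd (V s)) \<in> Pk (k - 1) (subinterval t n) Vh \<longrightarrow>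
        (LINT s:subinterval t n|lebesgue.
            l2_inner2 \<Omega> (local_dt2 t n U s) (V s) + l2_inner2 \<Omega> (wave_op A (U s)) (V s))
        = gl_quad t k \<xi> \<omega> n (\<lambda>s. l2_inner2 \<Omega> (source f s) (V s)))"

definition is_lifting_poly ::
  "(nat \<Rightarrow> real) \<Rightarrow> nat \<Rightarrow> (nat \<Rightarrow> real) \<Rightarrow> nat \<Rightarrow> real poly \<Rightarrow> bool" where
  "is_lifting_poly t k \<xi> n \<theta> \<longleftrightarrow>
     degree \<theta> \<le> k + 1 \<and> (\<forall>\<mu>\<le>k. poly \<theta> (gl_node t \<xi> n \<mu>) = 0) \<and>
     poly (pderiv \<theta>) (t (n - 1)) = 1"

text \<open>For one component \<open>u\<close>, \<open>lift_coeff t \<theta> d0 u n\<close> is \<open>c\<^sub>n\<close>, where \<open>d0\<close> is the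
  prescribed initial time derivative of the lifted function; \<open>lift_piece t \<theta> d0 u n\<close> is the
  lifted function on the subinterval with number \<open>n \<ge> 1\<close>.\<close>

primrec lift_coeff ::
  "(nat \<Rightarrow> real) \<Rightarrow> (nat \<Rightarrow> real poly) \<Rightarrow> 'd sfun \<Rightarrow> (real \<Rightarrow> 'd sfun) \<Rightarrow> nat \<Rightarrow> 'd sfun" where
  "lift_coeff t \<theta> d0 u 0 = local_dt t 1 u (t 0) - d0"
| "lift_coeff t \<theta> d0 u (Suc n) =
     local_dt t (Suc (Suc n)) u (t (Suc n))
     - local_dt t (Suc n) (\<lambda>s x. u s x - lift_coeff t \<theta> d0 u n x * poly (\<theta> (Suc n)) s) (t (Suc n))"

definition lift_piece ::
  "(nat \<Rightarrow> real) \<Rightarrow> (nat \<Rightarrow> real poly) \<Rightarrow> 'd sfun \<Rightarrow> (real \<Rightarrow> 'd sfun) \<Rightarrow> nat \<Rightarrow> real \<Rightarrow> 'd sfun" where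
  "lift_piece t \<theta> d0 u n s = (\<lambda>x. u s x - lift_coeff t \<theta> d0 u (n - 1) x * poly (\<theta> n) s)"

definition lift_comp ::
  "(nat \<Rightarrow> real) \<Rightarrow> nat \<Rightarrow> (nat \<Rightarrow> real poly) \<Rightarrow> 'd sfun \<Rightarrow> (real \<Rightarrow> 'd sfun) \<Rightarrow> real \<Rightarrow> 'd sfun" where
  "lift_comp t N \<theta> d0 u s =
     (if s = 0 then u 0
      else lift_piece t \<theta> d0 u (THE n. n \<in> {1..N} \<and> s \<in> subinterval t n) s)"

definition lift_init_dt ::
  "('d sfun \<Rightarrow> 'd sfun) \<Rightarrow> ('d sfun \<Rightarrow> 'd sfun) \<Rightarrow> (real \<Rightarrow> 'd sfun) \<Rightarrow> 'd sfun \<times> 'd sfun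
     \<Rightarrow> 'd sfun \<times> 'd sfun" where
  "lift_init_dt P A f U0 = proj2 P (source f 0) - wave_op A U0"

definition lifted_solution ::
  "(nat \<Rightarrow> real) \<Rightarrow> nat \<Rightarrow> (nat \<Rightarrow> real poly) \<Rightarrow> 'd sfun \<times> 'd sfun \<Rightarrow> (real \<Rightarrow> 'd sfun \<times> 'd sfun)
     \<Rightarrow> real \<Rightarrow> 'd sfun \<times> 'd sfun" where
  "lifted_solution t N \<theta> D0 U s =
     (lift_comp t N \<theta> (fst D0) (\<lambda>r. fst (U r)) s,
      lift_comp t N \<theta> (snd D0) (\<lambda>r. snd (U r)) s)"

end

theory Submission
  imports Defs
begin

text \<open>Testing the homogeneous scheme on \<open>I\<^sub>n\<close> with \<open>{-\<partial>\<^sub>t u\<^sup>1, \<partial>\<^sub>t u\<^sup>0}\<close>, an admissible choice of degree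
  \<open>k - 1\<close>, cancels the terms with two time derivatives and leaves
  \<open>\<integral> \<langle>u\<^sup>1, \<partial>\<^sub>t u\<^sup>1\<rangle> + \<langle>A u\<^sup>0, \<partial>\<^sub>t u\<^sup>0\<rangle> = 0\<close>. The integrand is half the time derivative of the energy, so the
  energy agrees at both ends of \<open>I\<^sub>n\<close>. The lifted solution coincides with the unlifted one at every
  \<open>t\<^sub>n\<close>, because \<open>t\<^sub>n\<close> is a Gauss-Lobatto node and hence a zero of the lifting polynomial.\<close>

section \<open>The \<open>L\<^sup>2\<close> inner product\<close>

text \<open>Cauchy-Schwarz and Young's inequality bound the product by the integrable
  \<open>(norm (u x))\<^sup>2 + (norm (v x))\<^sup>2\<close>. Measurability comes from the product
  of the two extensions by zero.\<close>

lemma square_integrable_inner: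
  assumes "square_integrable \<Omega> u" and "square_integrable \<Omega> v"
  shows "set_integrable lebesgue \<Omega> (\<lambda>x. u x \<bullet> v x)"
  unfolding set_integrable_def
proof (rule Bochner_Integration.integrable_bound)
  have u: "set_borel_measurable lebesgue \<Omega> u" "set_integrable lebesgue \<Omega> (\<lambda>x. (norm (u x))\<^sup>2)"
    and v: "set_borel_measurable lebesgue \<Omega> v" "set_integrable lebesgue \<Omega> (\<lambda>x. (norm (v x))\<^sup>2)"
    using assms by (auto simp: square_integrable_def)
  show "integrable lebesgue (\<lambda>x. indicator \<Omega> x *\<^sub>R ((norm (u x))\<^sup>2 + (norm (v x))\<^sup>2))"
    using set_integral_add(1)[OF u(2) v(2)] by (simp add: set_integrable_def)
  have "(\<lambda>x. (indicator \<Omega> x *\<^sub>R u x) \<bullet> (indicator \<Omega> x *\<^sub>R v x)) \<in> borel_measurable lebesgue"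
    using u(1) v(1) unfolding set_borel_measurable_def by (rule borel_measurable_inner)
  also have "(\<lambda>x. (indicator \<Omega> x *\<^sub>R u x) \<bullet> (indicator \<Omega> x *\<^sub>R v x))
      = (\<lambda>x. indicat_real \<Omega> x *\<^sub>R (u x \<bullet> v x))"
    by (auto simp: indicator_def)
  finally show "(\<lambda>x. indicat_real \<Omega> x *\<^sub>R (u x \<bullet> v x)) \<in> borel_measurable lebesgue" .
  have "\<bar>u x \<bullet> v x\<bar> \<le> (norm (u x))\<^sup>2 + (norm (v x))\<^sup>2" for x
  proof -
    have "\<bar>u x \<bullet> v x\<bar> \<le> norm (u x) * norm (v x)"
      by (rule Cauchy_Schwarz_ineq2)
    also have "\<dots> \<le> (norm (u x))\<^sup>2 + (norm (v x))\<^sup>2"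
      using sum_squares_bound[of "norm (u x)" "norm (v x)"]
        mult_nonneg_nonneg[OF norm_ge_zero[of "u x"] norm_ge_zero[of "v x"]] by linarith
    finally show ?thesis .
  qed
  then show "AE x in lebesgue. norm (indicat_real \<Omega> x *\<^sub>R (u x \<bullet> v x))
      \<le> norm (indicat_real \<Omega> x *\<^sub>R ((norm (u x))\<^sup>2 + (norm (v x))\<^sup>2))"
    by (auto simp: indicator_def)
qed

lemma square_integrable_scaleR:
  assumes "square_integrable \<Omega> u"
  shows "square_integrable \<Omega> (\<lambda>x. a *\<^sub>R u x)"
proof -
  have "(\<lambda>x. indicator \<Omega> x *\<^sub>R u x) \<in> borel_measurable lebesgue"
    using assms by (simp add: square_integrable_def set_borel_measurable_def)
  then have "(\<lambda>x. a *\<^sub>R (indicator \<Omega> x *\<^sub>R u x)) \<in> borel_measurable lebesgue"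
    by (rule borel_measurable_scaleR[OF borel_measurable_const])
  then have "set_borel_measurable lebesgue \<Omega> (\<lambda>x. a *\<^sub>R u x)"
    by (simp add: set_borel_measurable_def scaleR_left_commute del: scaleR_scaleR)
  moreover have "set_integrable lebesgue \<Omega> (\<lambda>x. a\<^sup>2 * (norm (u x))\<^sup>2)"
    using assms by (auto simp: square_integrable_def)
  ultimately show ?thesis
    by (simp add: square_integrable_def power_mult_distrib)
qed

lemma square_integrable_add:
  assumes "square_integrable \<Omega> u" and "square_integrable \<Omega> v"
  shows "square_integrable \<Omega> (\<lambda>x. u x + v x)"
proof -
  have "(\<lambda>x. indicator \<Omega> x *\<^sub>R u x + indicator \<Omega> x *\<^sub>R v x) \<in> borel_measurable lebesgue"
    using assms by (auto simp: square_integrable_def set_borel_measurable_def)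
  then have "set_borel_measurable lebesgue \<Omega> (\<lambda>x. u x + v x)"
    by (simp add: set_borel_measurable_def scaleR_add_right)
  moreover have "set_integrable lebesgue \<Omega> (\<lambda>x. (norm (u x))\<^sup>2 + 2 * (u x \<bullet> v x) + (norm (v x))\<^sup>2)"
    using assms square_integrable_inner[OF assms]
    by (auto simp: square_integrable_def intro!: set_integral_add)
  moreover have "(norm (u x + v x))\<^sup>2 = (norm (u x))\<^sup>2 + 2 * (u x \<bullet> v x) + (norm (v x))\<^sup>2" for x
    by (simp add: power2_norm_eq_inner inner_add_left inner_add_right inner_commute)
  ultimately show ?thesis
    by (simp add: square_integrable_def)
qed

lemma square_integrable_sum:
  assumes "finite J" and "\<And>j. j \<in> J \<Longrightarrow> square_integrable \<Omega> (u j)"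
  shows "square_integrable \<Omega> (\<lambda>x. \<Sum>j\<in>J. a j *\<^sub>R u j x)"
  using assms
proof (induction J rule: finite_induct)
  case empty
  then show ?case
    by (simp add: square_integrable_def set_borel_measurable_def set_integrable_def)
next
  case (insert i J)
  then show ?case
    by (simp add: square_integrable_add square_integrable_scaleR)
qed

lemma square_integrable_diff:
  assumes "square_integrable \<Omega> u" and "square_integrable \<Omega> v"
  shows "square_integrable \<Omega> (\<lambda>x. u x - v x)"
  using square_integrable_add[OF assms(1) square_integrable_scaleR[OF assms(2), of "-1"]] by simp

lemma l2_inner_commute: "l2_inner \<Omega> u v = l2_inner \<Omega> v u"
  by (simp add: l2_inner_def inner_commute)

lemma l2_inner_scaleR: "l2_inner \<Omega> (\<lambda>x. a *\<^sub>R u x) (\<lambda>x. b *\<^sub>R v x) = a * b * l2_inner \<Omega> u v"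
proof -
  have "l2_inner \<Omega> (\<lambda>x. a *\<^sub>R u x) (\<lambda>x. b *\<^sub>R v x) = (LINT x:\<Omega>|lebesgue. (a * b) * (u x \<bullet> v x))"
    by (simp add: l2_inner_def mult.assoc)
  then show ?thesis
    by (simp add: l2_inner_def)
qed

lemma l2_inner_add_right:
  assumes "square_integrable \<Omega> u" and "square_integrable \<Omega> v" and "square_integrable \<Omega> w"
  shows "l2_inner \<Omega> u (\<lambda>x. v x + w x) = l2_inner \<Omega> u v + l2_inner \<Omega> u w"
  using square_integrable_inner[OF assms(1,2)] square_integrable_inner[OF assms(1,3)]
  by (simp add: l2_inner_def inner_add_right set_integral_add)

lemma l2_inner_diff_right:
  assumes "square_integrable \<Omega> u" and "square_integrable \<Omega> v" and "square_integrable \<Omega> w"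
  shows "l2_inner \<Omega> u (\<lambda>x. v x - w x) = l2_inner \<Omega> u v - l2_inner \<Omega> u w"
  using square_integrable_inner[OF assms(1,2)] square_integrable_inner[OF assms(1,3)]
  by (simp add: l2_inner_def inner_diff_right set_integral_diff)

lemma l2_inner_sum_right:
  assumes "finite J" and "square_integrable \<Omega> u" and "\<And>j. j \<in> J \<Longrightarrow> square_integrable \<Omega> (v j)"
  shows "l2_inner \<Omega> u (\<lambda>x. \<Sum>j\<in>J. a j *\<^sub>R v j x) = (\<Sum>j\<in>J. a j * l2_inner \<Omega> u (v j))"
  using assms(1,3)
proof (induction J rule: finite_induct)
  case empty
  then show ?case
    by (simp add: l2_inner_def set_lebesgue_integral_def)
next
  case (insert i J)
  have "l2_inner \<Omega> u (\<lambda>x. a i *\<^sub>R v i x) = a i * l2_inner \<Omega> u (v i)"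
    using l2_inner_scaleR[of \<Omega> 1 u "a i" "v i"] by simp
  then show ?case
    using insert by (simp add: l2_inner_add_right[OF assms(2)] square_integrable_scaleR
        square_integrable_sum)
qed

text \<open>The nonnegative integrand \<open>z x \<bullet> z x\<close> has integral zero, so
  \<open>z\<close> vanishes almost everywhere on \<Omega>, and with it every product with
  \<open>z\<close>.\<close>

lemma l2_inner_null:
  assumes "square_integrable \<Omega> z" and "l2_inner \<Omega> z z = 0"
  shows "l2_inner \<Omega> u z = 0"
proof -
  have "AE x in lebesgue. indicator \<Omega> x *\<^sub>R (z x \<bullet> z x) = 0"
    using assms(2) square_integrable_inner[OF assms(1,1)]
    unfolding l2_inner_def set_lebesgue_integral_def set_integrable_def
    by (subst (asm) integral_nonneg_eq_0_iff_AE) (auto simp: indicator_def)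
  then have "AE x in lebesgue. indicator \<Omega> x *\<^sub>R (u x \<bullet> z x) = 0"
    by eventually_elim (auto simp: indicator_def)
  then show ?thesis
    unfolding l2_inner_def set_lebesgue_integral_def by (rule integral_eq_zero_AE)
qed

text \<open>Functions are not taken modulo null sets, so equality in L2 is expressed by a difference
  of zero norm. It still permits exchanging the two functions inside an inner product.\<close>

lemma l2_inner_eq_of_null_diff:
  assumes "square_integrable \<Omega> u" and "square_integrable \<Omega> v" and "square_integrable \<Omega> w"
    and "l2_inner \<Omega> (\<lambda>x. v x - w x) (\<lambda>x. v x - w x) = 0"
  shows "l2_inner \<Omega> u v = l2_inner \<Omega> u w"
  using l2_inner_null[OF square_integrable_diff[OF assms(2,3)] assms(4), of u]
    l2_inner_diff_right[OF assms(1-3)] by simp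

section \<open>Scaling invariance of the finite element space\<close>

lemma GDERIV_scale: "GDERIV \<phi> x :> D \<Longrightarrow> GDERIV (\<lambda>x. a * \<phi> x) x :> a *\<^sub>R D"
  unfolding gderiv_def by (auto intro!: derivative_eq_intros simp: algebra_simps)

lemma Ck_scale: "Ck m \<phi> \<Longrightarrow> Ck m (\<lambda>x. a * \<phi> x)"
proof (induction m arbitrary: \<phi>)
  case 0
  then show ?case by (auto intro!: continuous_intros)
next
  case (Suc m)
  then obtain g where g: "\<And>x. GDERIV \<phi> x :> g x" "\<And>i. Ck m (\<lambda>x. g x $ i)"
    by auto
  have "GDERIV (\<lambda>x. a * \<phi> x) x :> a *\<^sub>R g x" for x
    by (rule GDERIV_scale) (rule g)
  moreover have "Ck m (\<lambda>x. (a *\<^sub>R g x) $ i)" for i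
    using Suc.IH[OF g(2)[of i]] by simp
  ultimately show ?case
    by (auto intro!: exI[of _ "\<lambda>x. a *\<^sub>R g x"])
qed

lemma classical_grad_eq: "GDERIV \<phi> x :> D \<Longrightarrow> classical_grad \<phi> x = D"
  unfolding classical_grad_def gderiv_def
  by (rule the_equality) (auto dest: has_derivative_unique simp: fun_eq_iff vector_eq_ldot)

lemma classical_grad_scale:
  assumes "\<phi> \<in> test_functions \<Omega>"
  shows "classical_grad (\<lambda>x. a * \<phi> x) x = a *\<^sub>R classical_grad \<phi> x"
proof -
  have "Ck 1 \<phi>"
    using assms by (auto simp: test_functions_def)
  then obtain D where "GDERIV \<phi> x :> D"
    by auto
  then show ?thesis
    using classical_grad_eq GDERIV_scale by metis
qed

lemma test_functions_scale:
  assumes "\<phi> \<in> test_functions \<Omega>"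
  shows "(\<lambda>x. a * \<phi> x) \<in> test_functions \<Omega>"
proof -
  have "{x. a * \<phi> x \<noteq> 0} \<subseteq> {x. \<phi> x \<noteq> 0}"
    by auto
  then have *: "closure {x. a * \<phi> x \<noteq> 0} \<subseteq> closure {x. \<phi> x \<noteq> 0}"
    by (rule closure_mono)
  have \<phi>: "\<And>m. Ck m \<phi>" "compact (closure {x. \<phi> x \<noteq> 0})" "closure {x. \<phi> x \<noteq> 0} \<subseteq> \<Omega>"
    using assms by (simp_all add: test_functions_def)
  \<comment> \<open>The support may shrink to the empty set when \<open>a = 0\<close>; as a closed
    subset of a compact set it is compact for every \<open>a\<close>.\<close>
  have "compact (closure {x. a * \<phi> x \<noteq> 0})"
    using compact_Int_closed[OF \<phi>(2) closed_closure[of "{x. a * \<phi> x \<noteq> 0}"]]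
    unfolding inf_absorb2[OF *] .
  then show ?thesis
    unfolding test_functions_def
    by (intro CollectI conjI allI Ck_scale \<phi>(1) subset_trans[OF * \<phi>(3)])
qed

lemma l2_norm_scaleR: "l2_norm \<Omega> (\<lambda>x. a *\<^sub>R u x) = \<bar>a\<bar> * l2_norm \<Omega> u"
  by (simp add: l2_norm_def l2_inner_scaleR real_sqrt_mult)

lemma has_weak_grad_scale:
  assumes "has_weak_grad \<Omega> u g"
  shows "has_weak_grad \<Omega> (\<lambda>x. a * u x) (\<lambda>x. a *\<^sub>R g x)"
proof -
  have "(LINT x:\<Omega>|lebesgue. (a * u x) *\<^sub>R classical_grad \<phi> x) = - (LINT x:\<Omega>|lebesgue. \<phi> x *\<^sub>R a *\<^sub>R g x)"
    if "\<phi> \<in> test_functions \<Omega>" for \<phi>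
  proof -
    have "(LINT x:\<Omega>|lebesgue. (a * u x) *\<^sub>R classical_grad \<phi> x)
        = a *\<^sub>R (LINT x:\<Omega>|lebesgue. u x *\<^sub>R classical_grad \<phi> x)"
      by (simp flip: scaleR_scaleR)
    also have "\<dots> = - (a *\<^sub>R (LINT x:\<Omega>|lebesgue. \<phi> x *\<^sub>R g x))"
      using assms that by (simp add: has_weak_grad_def)
    also have "a *\<^sub>R (LINT x:\<Omega>|lebesgue. \<phi> x *\<^sub>R g x) = (LINT x:\<Omega>|lebesgue. \<phi> x *\<^sub>R a *\<^sub>R g x)"
      by (subst set_integral_scaleR_right[symmetric]) (simp add: mult.commute)
    finally show ?thesis .
  qed
  then show ?thesis
    using assms square_integrable_scaleR[of \<Omega> u a] square_integrable_scaleR[of \<Omega> g a]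
    by (simp add: has_weak_grad_def)
qed

text \<open>Multiples of the approximating test functions approximate the multiple of
  \<open>u\<close>, since the L2 norm is absolutely homogeneous.\<close>

lemma H10_scale:
  assumes "u \<in> H10 \<Omega>"
  shows "(\<lambda>x. a * u x) \<in> H10 \<Omega>"
proof -
  obtain g \<phi> where g: "has_weak_grad \<Omega> u g" and \<phi>: "\<And>m::nat. \<phi> m \<in> test_functions \<Omega>"
    and lim: "(\<lambda>m. l2_norm \<Omega> (\<lambda>x. \<phi> m x - u x)) \<longlonglongrightarrow> 0"
      "(\<lambda>m. l2_norm \<Omega> (\<lambda>x. classical_grad (\<phi> m) x - g x)) \<longlonglongrightarrow> 0"
    using assms by (auto simp: H10_def)
  have "(\<lambda>m. l2_norm \<Omega> (\<lambda>x. a * \<phi> m x - a * u x)) \<longlonglongrightarrow> 0"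
    using tendsto_mult_right_zero[OF lim(1), of "\<bar>a\<bar>"]
    by (simp flip: l2_norm_scaleR add: right_diff_distrib)
  moreover have "(\<lambda>m. l2_norm \<Omega> (\<lambda>x. classical_grad (\<lambda>x. a * \<phi> m x) x - a *\<^sub>R g x)) \<longlonglongrightarrow> 0"
    using tendsto_mult_right_zero[OF lim(2), of "\<bar>a\<bar>"]
    by (simp flip: l2_norm_scaleR add: scaleR_diff_right classical_grad_scale[OF \<phi>])
  ultimately show ?thesis
    using has_weak_grad_scale[OF g, of a] test_functions_scale[OF \<phi>, of a]
    unfolding H10_def
    by (intro CollectI exI[of _ "\<lambda>x. a *\<^sub>R g x"] conjI exI[of _ "\<lambda>m x. a * \<phi> m x"] allI)
qed

lemma Qr_scale:
  assumes "p \<in> Qr r"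
  shows "(\<lambda>x. a * p x) \<in> Qr r"
proof -
  obtain c where "\<And>x. p x = (\<Sum>\<alpha> \<in> {\<alpha>. \<forall>i. \<alpha> i \<le> r}. c \<alpha> * (\<Prod>i\<in>UNIV. (x $ i) ^ \<alpha> i))"
    using assms by (auto simp: Qr_def)
  then have "\<forall>x. a * p x = (\<Sum>\<alpha> \<in> {\<alpha>. \<forall>i. \<alpha> i \<le> r}. (a * c \<alpha>) * (\<Prod>i\<in>UNIV. (x $ i) ^ \<alpha> i))"
    by (simp add: sum_distrib_left mult.assoc)
  then show ?thesis
    unfolding Qr_def by (intro CollectI exI[of _ "\<lambda>\<alpha>. a * c \<alpha>"])
qed

text \<open>Differentiation in time turns the coefficients of a trial function into multiples of
  them, and the test function also carries a sign. This closure keeps such multiples inside the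
  finite element space.\<close>

lemma fe_space_scale:
  assumes "v \<in> fe_space \<Omega> \<T> \<Phi> r"
  shows "(\<lambda>x. a * v x) \<in> fe_space \<Omega> \<T> \<Phi> r"
proof -
  have "\<exists>p\<in>Qr r. \<forall>\<xi>\<in>ref_cell. a * v (\<Phi> K \<xi>) = p \<xi>" if K: "K \<in> \<T>" for K
  proof -
    obtain p where "p \<in> Qr r" "\<forall>\<xi>\<in>ref_cell. v (\<Phi> K \<xi>) = p \<xi>"
      using assms K by (auto simp: fe_space_def)
    then show ?thesis
      by (intro bexI[of _ "\<lambda>x. a * p x"]) (auto simp: Qr_scale)
  qed
  then show ?thesis
    using assms by (auto simp: fe_space_def H10_scale intro!: continuous_intros)
qed

lemma fe_space_subset_H10: "fe_space \<Omega> \<T> \<Phi> r \<subseteq> H10 \<Omega>"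
  by (auto simp: fe_space_def)

lemma H10_square_integrable: "u \<in> H10 \<Omega> \<Longrightarrow> square_integrable \<Omega> u"
  by (auto simp: H10_def has_weak_grad_def)

section \<open>Energy of polynomials in time\<close>

text \<open>Both sides equal the L2 product of the weak gradients of \<open>u\<close> and
  \<open>v\<close>, which is symmetric.\<close>

lemma discrete_laplacian_symmetric:
  assumes "is_discrete_laplacian \<Omega> V A" and "V \<subseteq> H10 \<Omega>" and "u \<in> V" and "v \<in> V"
  shows "l2_inner \<Omega> (A u) v = l2_inner \<Omega> (A v) u"
proof -
  have "l2_inner \<Omega> (A x) y = l2_inner \<Omega> (weak_grad \<Omega> x) (weak_grad \<Omega> y)"
    if "x \<in> V" "y \<in> V" for x y
    using assms(1,2) that by (auto simp: is_discrete_laplacian_def)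
  then show ?thesis
    using assms(3,4) by (simp add: l2_inner_commute)
qed

text \<open>The quadratic form of the matrix \<open>M\<close> at the vector of monomials
  \<open>1, s, ..., s ^ k\<close>. With a Gram matrix of coefficients it is the squared norm of a
  polynomial in time.\<close>

definition quadform :: "nat \<Rightarrow> (nat \<Rightarrow> nat \<Rightarrow> real) \<Rightarrow> real \<Rightarrow> real" where
  "quadform k M s = (\<Sum>i\<le>k. \<Sum>j\<le>k. s ^ i * s ^ j * M i j)"

text \<open>Agreement of \<open>w\<close> with the time polynomial at \<open>s\<close> is demanded
  only up to a null function, because no more is known at the left endpoint of a
  subinterval.\<close>

lemma l2_inner_polynomial:
  assumes "square_integrable \<Omega> w" and "\<And>j. j \<le> k \<Longrightarrow> square_integrable \<Omega> (c j)"
    and "l2_inner \<Omega> (\<lambda>x. w x - (\<Sum>j\<le>k. s ^ j * c j x)) (\<lambda>x. w x - (\<Sum>j\<le>k. s ^ j * c j x)) = 0"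
    and "square_integrable \<Omega> u"
  shows "l2_inner \<Omega> u w = (\<Sum>j\<le>k. s ^ j * l2_inner \<Omega> u (c j))"
proof -
  have "square_integrable \<Omega> (\<lambda>x. \<Sum>j\<le>k. s ^ j * c j x)"
    using square_integrable_sum[of "{..k}" \<Omega> c "\<lambda>j. s ^ j"] assms(2) by simp
  then have "l2_inner \<Omega> u w = l2_inner \<Omega> u (\<lambda>x. \<Sum>j\<le>k. s ^ j * c j x)"
    using assms by (intro l2_inner_eq_of_null_diff)
  also have "\<dots> = (\<Sum>j\<le>k. s ^ j * l2_inner \<Omega> u (c j))"
    using l2_inner_sum_right[of "{..k}" \<Omega> u c "\<lambda>j. s ^ j"] assms(2,4) by simp
  finally show ?thesis .
qed

lemma l2_inner_self_polynomial:
  assumes "square_integrable \<Omega> w" and "\<And>j. j \<le> k \<Longrightarrow> square_integrable \<Omega> (c j)"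
    and "l2_inner \<Omega> (\<lambda>x. w x - (\<Sum>j\<le>k. s ^ j * c j x)) (\<lambda>x. w x - (\<Sum>j\<le>k. s ^ j * c j x)) = 0"
  shows "l2_inner \<Omega> w w = quadform k (\<lambda>i j. l2_inner \<Omega> (c i) (c j)) s"
proof -
  have "l2_inner \<Omega> w w = (\<Sum>i\<le>k. s ^ i * l2_inner \<Omega> w (c i))"
    by (rule l2_inner_polynomial) (use assms in auto)
  also have "\<dots> = (\<Sum>i\<le>k. s ^ i * (\<Sum>j\<le>k. s ^ j * l2_inner \<Omega> (c i) (c j)))"
    by (subst l2_inner_commute, intro sum.cong refl arg_cong2[where f = "(*)"]
        l2_inner_polynomial) (use assms in auto)
  finally show ?thesis
    by (simp add: quadform_def sum_distrib_left mult.assoc)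
qed

text \<open>Weak gradients are never compared: linearity of the Dirichlet form in its second argument is
  inherited from the \<open>L\<^sup>2\<close> pairing with \<open>A w\<close>, and linearity in the first one from symmetry.\<close>

lemma dirichlet_self_polynomial:
  assumes "is_discrete_laplacian \<Omega> V A" and "V \<subseteq> H10 \<Omega>" and "w \<in> V" and "\<And>j. j \<le> k \<Longrightarrow> c j \<in> V"
    and "l2_inner \<Omega> (\<lambda>x. w x - (\<Sum>j\<le>k. s ^ j * c j x)) (\<lambda>x. w x - (\<Sum>j\<le>k. s ^ j * c j x)) = 0"
  shows "l2_inner \<Omega> (weak_grad \<Omega> w) (weak_grad \<Omega> w) = quadform k (\<lambda>i j. l2_inner \<Omega> (A (c i)) (c j)) s"
proof -
  have A: "A v \<in> V" if "v \<in> V" for v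
    using assms(1,2) that by (auto simp: is_discrete_laplacian_def)
  have sq: "square_integrable \<Omega> v" if "v \<in> V" for v
    using assms(2) that H10_square_integrable by blast
  have "l2_inner \<Omega> (weak_grad \<Omega> w) (weak_grad \<Omega> w) = l2_inner \<Omega> (A w) w"
    using assms(1-3) by (metis is_discrete_laplacian_def subsetD)
  also have "\<dots> = (\<Sum>i\<le>k. s ^ i * l2_inner \<Omega> (A w) (c i))"
    by (rule l2_inner_polynomial) (use assms A sq in auto)
  also have "\<dots> = (\<Sum>i\<le>k. s ^ i * l2_inner \<Omega> (A (c i)) w)"
    using discrete_laplacian_symmetric[OF assms(1-3)] assms(4) by (intro sum.cong) auto
  also have "\<dots> = (\<Sum>i\<le>k. s ^ i * (\<Sum>j\<le>k. s ^ j * l2_inner \<Omega> (A (c i)) (c j)))"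
    by (intro sum.cong refl arg_cong2[where f = "(*)"] l2_inner_polynomial) (use assms A sq in auto)
  finally show ?thesis
    by (simp add: quadform_def sum_distrib_left mult.assoc)
qed

section \<open>Differentiating and integrating the energy in time\<close>

lemma quadform_add: "quadform k (\<lambda>i j. M i j + M' i j) s = quadform k M s + quadform k M' s"
  by (simp add: quadform_def distrib_left sum.distrib)

text \<open>The product rule yields two double sums, which coincide after exchanging
  \<open>i\<close> and \<open>j\<close> by symmetry of \<open>M\<close>. The remaining one has the
  shape that the tested scheme produces. For \<open>j = 0\<close> the truncated exponent
  \<open>j - 1\<close> is harmless because of the factor \<open>of_nat j\<close>.\<close>

lemma quadform_has_derivative:
  assumes "\<And>i j. i \<le> k \<Longrightarrow> j \<le> k \<Longrightarrow> M i j = M j i"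
  shows "(quadform k M has_real_derivative
    2 * (\<Sum>i\<le>k. \<Sum>j\<le>k. s ^ i * (of_nat j * s ^ (j - 1)) * M i j)) (at s within S)"
proof -
  have "(quadform k M has_real_derivative
      (\<Sum>i\<le>k. \<Sum>j\<le>k. (of_nat i * s ^ (i - 1) * s ^ j + s ^ i * (of_nat j * s ^ (j - 1))) * M i j)) (at s within S)"
    unfolding quadform_def
  proof (intro DERIV_sum)
    fix i j
    show "((\<lambda>s. s ^ i * s ^ j * M i j) has_real_derivative
        (of_nat i * s ^ (i - 1) * s ^ j + s ^ i * (of_nat j * s ^ (j - 1))) * M i j) (at s within S)"
      by (rule derivative_eq_intros refl)+ simp
  qed
  moreover have "(\<Sum>i\<le>k. \<Sum>j\<le>k. of_nat i * s ^ (i - 1) * s ^ j * M i j)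
      = (\<Sum>i\<le>k. \<Sum>j\<le>k. s ^ i * (of_nat j * s ^ (j - 1)) * M i j)"
    by (subst sum.swap, intro sum.cong refl) (use assms in simp)
  ultimately show ?thesis
    by (simp add: distrib_right sum.distrib)
qed

text \<open>The fundamental theorem of calculus gives the gauge integral over the closed interval.
  Removing the point \<open>a\<close> does not change it, and continuity of \<open>G\<close> makes
  it agree with the Lebesgue integral over the half-open interval, the one in the scheme.\<close>

lemma set_lebesgue_integral_derivative:
  fixes F G :: "real \<Rightarrow> real"
  assumes "a \<le> b" and "\<And>s. s \<in> {a..b} \<Longrightarrow> (F has_real_derivative G s) (at s within {a..b})"
    and "continuous_on {a..b} G"
  shows "(LINT s:{a<..b}|lebesgue. G s) = F b - F a"
proof -
  have "set_integrable lebesgue {a..b} G"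
    using assms(3) by (simp add: integrable_continuous_interval absolutely_integrable_continuous_real)
  then have int: "set_integrable lebesgue {a<..b} G"
    by (rule set_integrable_subset) auto
  have "(G has_integral F b - F a) {a..b}"
    using assms by (intro fundamental_theorem_of_calculus)
      (auto simp: has_real_derivative_iff_has_vector_derivative)
  moreover have "(G has_integral I) {a..b} \<longleftrightarrow> (G has_integral I) {a<..b}" for I
    by (rule has_integral_spike_set_eq; rule negligible_subset[of "{a}"]; force)
  ultimately have "(G has_integral F b - F a) {a<..b}"
    by simp
  then show ?thesis
    by (simp add: set_lebesgue_integral_eq_integral(2)[OF int] integral_unique)
qed

section \<open>One-sided values on a subinterval\<close>

text \<open>Convergence determines \<open>Lim\<close> only along a nontrivial filter. Every point of
  the closed interval, endpoints included, is a limit point of the open one.\<close>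

lemma Lim_within_subinterval:
  fixes g :: "real \<Rightarrow> real"
  assumes "a < b" and "s \<in> {a..b}" and "(g \<longlongrightarrow> l) (at s within {a<..<b})"
  shows "Lim (at s within {a<..<b}) g = l"
proof -
  have "s = a \<or> s = b \<or> s \<in> interior {a<..<b}"
    using assms(2) by (auto simp: interior_open)
  then have "s islimpt {a<..<b}"
    using assms(1) islimpt_greaterThanLessThan1 islimpt_greaterThanLessThan2 interior_limit_point
    by blast
  then have "at s within {a<..<b} \<noteq> bot"
    by (simp add: trivial_limit_within)
  then show ?thesis
    using assms(3) by (rule tendsto_Lim)
qed

text \<open>The value depends only on \<open>g\<close> in the open subinterval, so a continuous
  \<open>h\<close> that agrees with \<open>g\<close> there supplies the one-sided limits at the
  endpoints.\<close>

lemma local_val_eq: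
  assumes "t (n - 1) < t n" and "s \<in> {t (n - 1)..t n}"
    and "\<And>r. t (n - 1) < r \<Longrightarrow> r < t n \<Longrightarrow> g r = h r" and "continuous_on {t (n - 1)..t n} h"
  shows "local_val t n g s = h s"
proof (cases "t (n - 1) < s \<and> s < t n")
  case False
  have "(h \<longlongrightarrow> h s) (at s within {t (n - 1)<..<t n})"
    by (rule tendsto_within_subset[where S = "{t (n - 1)..t n}"])
      (use assms(2,4) in \<open>auto simp: continuous_on_def\<close>)
  moreover have "\<forall>\<^sub>F r in at s within {t (n - 1)<..<t n}. g r = h r"
    using assms(3) by (auto simp: eventually_at_filter)
  ultimately have "(g \<longlongrightarrow> h s) (at s within {t (n - 1)<..<t n})"
    by (simp add: tendsto_cong)
  with False assms(1,2) show ?thesis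
    by (auto simp: local_val_def Lim_within_subinterval)
qed (use assms in \<open>simp add: local_val_def\<close>)

text \<open>The two-sided \<open>deriv\<close> is computed in the open subinterval, where a whole
  neighbourhood carries the polynomial representation. The endpoint values follow by continuity of
  the differentiated polynomial.\<close>

lemma local_dt_polynomial:
  assumes "t (n - 1) < t n" and "s \<in> {t (n - 1)..t n}"
    and "\<And>s x. s \<in> subinterval t n \<Longrightarrow> w s x = (\<Sum>j\<le>k. s ^ j * c j x)"
  shows "local_dt t n w s x = (\<Sum>j\<le>k. (of_nat j * s ^ (j - 1)) * c j x)"
  unfolding local_dt_def
proof (rule local_val_eq[where h = "\<lambda>s. \<Sum>j\<le>k. (of_nat j * s ^ (j - 1)) * c j x"])
  fix r
  assume r: "t (n - 1) < r" "r < t n"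
  have "((\<lambda>s. \<Sum>j\<le>k. s ^ j * c j x) has_real_derivative
      (\<Sum>j\<le>k. (of_nat j * r ^ (j - 1)) * c j x)) (at r)"
    by (auto intro!: derivative_eq_intros)
  then have "((\<lambda>s. w s x) has_real_derivative
      (\<Sum>j\<le>k. (of_nat j * r ^ (j - 1)) * c j x)) (at r)"
    by (rule has_field_derivative_transform_within_open[where S = "{t (n - 1)<..<t n}"]) (use r assms(3) in auto)
  then show "deriv (\<lambda>s. w s x) r = (\<Sum>j\<le>k. (of_nat j * r ^ (j - 1)) * c j x)"
    by (rule DERIV_imp_deriv)
qed (use assms in \<open>auto intro!: continuous_intros\<close>)

text \<open>The summand with \<open>j = 0\<close> vanishes, and shifting the index lowers the degree
  by one. This makes a scaled time derivative an admissible test function.\<close>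

lemma polynomial_derivative_in_Pk:
  assumes "k \<ge> 1" and "\<And>j. j \<le> k \<Longrightarrow> c j \<in> B" and "\<And>v a. v \<in> B \<Longrightarrow> (\<lambda>x. a * v x) \<in> B"
  shows "(\<lambda>s x. a * (\<Sum>j\<le>k. (of_nat j * s ^ (j - 1)) * c j x)) \<in> Pk (k - 1) I B"
proof -
  obtain m where k: "k = Suc m"
    using assms(1) by (cases k) auto
  have "(\<Sum>j\<le>k. (of_nat j * s ^ (j - 1)) * c j x) = (\<Sum>j\<le>m. s ^ j * (of_nat (Suc j) * c (Suc j) x))"
    for s :: real and x
    unfolding k by (subst sum.atMost_Suc_shift) (simp add: algebra_simps)
  then have "a * (\<Sum>j\<le>k. (of_nat j * s ^ (j - 1)) * c j x)
      = (\<Sum>j\<le>k - 1. s ^ j * ((a * of_nat (Suc j)) * c (Suc j) x))"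
    for s :: real and x
    unfolding k by (simp add: sum_distrib_left mult_ac)
  moreover have "(\<lambda>x. (a * of_nat (Suc j)) * c (Suc j) x) \<in> B" if "j \<le> k - 1" for j
    by (rule assms(3)) (use assms(2)[of "Suc j"] that k in simp)
  ultimately show ?thesis
    unfolding Pk_def
    by (intro CollectI exI[of _ "\<lambda>j x. (a * of_nat (Suc j)) * c (Suc j) x"]) blast
qed

text \<open>The \<open>L\<^sup>2\<close> continuity of \<open>w\<close> at the left endpoint identifies \<open>w\<close> there, up to a null function,
  with the polynomial that represents it on the half-open subinterval.\<close>

lemma Xk_polynomial_null_diff:
  assumes w: "w \<in> Xk \<Omega> t N k V" and V: "\<And>v. v \<in> V \<Longrightarrow> square_integrable \<Omega> v"
    and t: "t (n - 1) < t n" "{t (n - 1)..t n} \<subseteq> {t 0..t N}"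
    and c: "\<And>j. j \<le> k \<Longrightarrow> c j \<in> V"
    and rep: "\<And>s x. s \<in> subinterval t n \<Longrightarrow> w s x = (\<Sum>j\<le>k. s ^ j * c j x)"
    and s: "s \<in> {t (n - 1)..t n}"
  shows "l2_inner \<Omega> (\<lambda>x. w s x - (\<Sum>j\<le>k. s ^ j * c j x)) (\<lambda>x. w s x - (\<Sum>j\<le>k. s ^ j * c j x)) = 0"
proof (cases "s = t (n - 1)")
  case False
  then show ?thesis
    using s rep by (simp add: l2_inner_def set_lebesgue_integral_def)
next
  case True
  define p where "p r = (\<lambda>x. \<Sum>j\<le>k. r ^ j * c j x)" for r :: real
  have ws: "square_integrable \<Omega> (w s)"
    using w s t(2) V by (auto simp: Xk_def)
  have sp: "square_integrable \<Omega> (p r)" for r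
    using square_integrable_sum[of "{..k}" \<Omega> c "\<lambda>j. r ^ j"] c V by (simp add: p_def)
  have up: "l2_inner \<Omega> u (p r) = (\<Sum>j\<le>k. r ^ j * l2_inner \<Omega> u (c j))"
    if "square_integrable \<Omega> u" for u r
    using l2_inner_sum_right[of "{..k}" \<Omega> u c "\<lambda>j. r ^ j"] c V that by (simp add: p_def)
  have pp: "l2_inner \<Omega> (p r) (p r) = (\<Sum>i\<le>k. r ^ i * (\<Sum>j\<le>k. r ^ j * l2_inner \<Omega> (c i) (c j)))" for r
    by (subst up[OF sp], intro sum.cong refl arg_cong2[where f = "(*)"],
        subst l2_inner_commute, rule up) (use c V in auto)
  \<comment> \<open>Expanding the square shows that the squared distance is a polynomial in
    \<open>r\<close>, hence that \<open>g\<close> below is continuous.\<close>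
  have expand: "l2_inner \<Omega> (\<lambda>x. p r x - w s x) (\<lambda>x. p r x - w s x)
      = l2_inner \<Omega> (p r) (p r) - 2 * l2_inner \<Omega> (w s) (p r) + l2_inner \<Omega> (w s) (w s)" for r
  proof -
    have d: "square_integrable \<Omega> (\<lambda>x. p r x - w s x)"
      by (rule square_integrable_diff[OF sp ws])
    have "l2_inner \<Omega> (\<lambda>x. p r x - w s x) (\<lambda>x. p r x - w s x)
        = l2_inner \<Omega> (p r) (\<lambda>x. p r x - w s x) - l2_inner \<Omega> (w s) (\<lambda>x. p r x - w s x)"
      by (simp add: l2_inner_diff_right[OF d sp ws] l2_inner_commute)
    then show ?thesis
      by (simp add: l2_inner_diff_right[OF sp sp ws] l2_inner_diff_right[OF ws sp ws]
          l2_inner_commute[of \<Omega> "p r" "w s"])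
  qed
  \<comment> \<open>The limit of \<open>g\<close> at \<open>s\<close> from inside is computed twice:
    continuity in \<open>r\<close> gives \<open>g s\<close>, while L2 continuity of
    \<open>w\<close>, which equals \<open>p\<close> inside the subinterval, gives 0.\<close>
  define g where "g r = l2_norm \<Omega> (\<lambda>x. p r x - w s x)" for r
  have "continuous_on UNIV g"
    unfolding g_def l2_norm_def expand pp up[OF ws] by (intro continuous_intros)
  then have "(g \<longlongrightarrow> g s) (at s within {t (n - 1)<..<t n})"
    by (auto simp: continuous_on_def intro: tendsto_within_subset)
  then have 1: "Lim (at s within {t (n - 1)<..<t n}) g = g s"
    using t(1) s by (intro Lim_within_subinterval)
  have "((\<lambda>r. l2_norm \<Omega> (\<lambda>x. w r x - w s x)) \<longlongrightarrow> 0) (at s within {t 0..t N})"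
    using w s t(2) by (auto simp: Xk_def)
  then have "((\<lambda>r. l2_norm \<Omega> (\<lambda>x. w r x - w s x)) \<longlongrightarrow> 0) (at s within {t (n - 1)<..<t n})"
    by (rule tendsto_within_subset) (use t(2) in auto)
  moreover have "\<forall>\<^sub>F r in at s within {t (n - 1)<..<t n}. l2_norm \<Omega> (\<lambda>x. w r x - w s x) = g r"
    using rep by (auto simp: eventually_at_filter g_def p_def)
  ultimately have "(g \<longlongrightarrow> 0) (at s within {t (n - 1)<..<t n})"
    by (simp add: tendsto_cong)
  then have "Lim (at s within {t (n - 1)<..<t n}) g = 0"
    using t(1) s by (intro Lim_within_subinterval)
  with 1 have "l2_inner \<Omega> (\<lambda>x. p s x - w s x) (\<lambda>x. p s x - w s x) = 0"
    by (simp add: g_def l2_norm_def)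
  then show ?thesis
    using l2_inner_scaleR[of \<Omega> "-1" "\<lambda>x. p s x - w s x" "-1" "\<lambda>x. p s x - w s x"]
    by (simp add: p_def)
qed

section \<open>Quadrature, lifting and energy conservation\<close>

lemma gauss_lobatto_node_bounds:
  assumes "gauss_lobatto k \<xi> \<omega>" and "\<mu> \<le> k"
  shows "\<xi> \<mu> \<in> {-1..1}"
proof -
  have mono: "\<xi> i \<le> \<xi> j" if "i \<le> j" "j \<le> k" for i j
    using that
  proof (induction j rule: dec_induct)
    case (step j)
    then show ?case
      using assms(1) by (force simp: gauss_lobatto_def dest: spec[of _ j])
  qed simp
  show ?thesis
    using mono[of 0 \<mu>] mono[of \<mu> k] assms by (auto simp: gauss_lobatto_def)
qed

lemma gl_node_in_subinterval:
  assumes "gauss_lobatto k \<xi> \<omega>" and "\<mu> \<le> k" and "t (n - 1) < t n"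
  shows "gl_node t \<xi> n \<mu> \<in> {t (n - 1)..t n}"
proof -
  have "\<bar>(t n - t (n - 1)) / 2 * \<xi> \<mu>\<bar> \<le> (t n - t (n - 1)) / 2 * 1"
    unfolding abs_mult using gauss_lobatto_node_bounds[OF assms(1,2)] assms(3)
    by (intro mult_mono) auto
  then show ?thesis
    by (auto simp: gl_node_def abs_le_iff field_simps)
qed

text \<open>At the endpoint nodes \<open>local_val\<close> takes limits from inside, so vanishing in
  the open subinterval settles all nodes.\<close>

lemma gl_quad_eq_zero:
  assumes "gauss_lobatto k \<xi> \<omega>" and "t (n - 1) < t n"
    and "\<And>s. t (n - 1) < s \<Longrightarrow> s < t n \<Longrightarrow> g s = 0"
  shows "gl_quad t k \<xi> \<omega> n g = 0"
proof -
  have "local_val t n g (gl_node t \<xi> n \<mu>) = 0" if "\<mu> \<le> k" for \<mu>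
    by (rule local_val_eq[where h = "\<lambda>_. 0"])
      (use assms gl_node_in_subinterval[OF assms(1) that assms(2)] in auto)
  then show ?thesis
    by (simp add: gl_quad_def)
qed

section \<open>The time mesh and the lifting at its points\<close>

lemma time_mesh_mono:
  assumes "time_mesh t N T" and "m \<le> n" and "n \<le> N"
  shows "t m \<le> t n"
  using assms(2,3)
proof (induction n rule: dec_induct)
  case (step n)
  have "t (Suc n - 1) < t (Suc n)"
    using assms(1) step.prems unfolding time_mesh_def by (metis Suc_leI atLeastAtMost_iff
        le_add1 plus_1_eq_Suc)
  with step show ?case by simp
qed simp

lemma lifted_solution_at_mesh_point:
  assumes "time_mesh t N T" and "gauss_lobatto k \<xi> \<omega>" and "n \<in> {1..N}"
    and "is_lifting_poly t k \<xi> n (\<theta> n)"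
  shows "lifted_solution t N \<theta> D0 U (t n) = U (t n)"
proof -
  have lt: "t (n - 1) < t n"
    using assms(1,3) by (auto simp: time_mesh_def)
  \<comment> \<open>This leads to \<open>t n \<noteq> 0\<close>, which excludes the separate case
    \<open>s = 0\<close> in \<open>lift_comp\<close>.\<close>
  have "t 0 \<le> t (n - 1)"
    using assms(3) by (intro time_mesh_mono[OF assms(1)]) auto
  with lt have "t n \<noteq> 0"
    using assms(1) by (auto simp: time_mesh_def)
  \<comment> \<open>The half-open subintervals are disjoint and \<open>t n\<close> is the right
    endpoint of the one with number \<open>n\<close>, so this is the piece that
    \<open>lift_comp\<close> selects.\<close>
  have the: "(THE m. m \<in> {1..N} \<and> t n \<in> subinterval t m) = n"
  proof (rule the_equality)
    fix m
    assume m: "m \<in> {1..N} \<and> t n \<in> subinterval t m"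
    show "m = n"
    proof (rule linorder_cases[of m n])
      assume "m < n"
      then have "t m \<le> t (n - 1)"
        using assms(3) by (intro time_mesh_mono[OF assms(1)]) auto
      with lt m show ?thesis by auto
    next
      assume "n < m"
      then have "t n \<le> t (m - 1)"
        using m by (intro time_mesh_mono[OF assms(1)]) auto
      with m show ?thesis by auto
    qed
  qed (use assms(3) lt in auto)
  have "gl_node t \<xi> n k = t n"
    using assms(2) by (simp add: gl_node_def gauss_lobatto_def field_simps)
  then have "poly (\<theta> n) (t n) = 0"
    using assms(4) by (auto simp: is_lifting_poly_def dest: spec[of _ k])
  then show ?thesis
    using \<open>t n \<noteq> 0\<close> unfolding lifted_solution_def lift_comp_def lift_piece_def the by simp
qed

text \<open>Twice the mechanical energy of the wave: the second component is the velocity, the first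
  one the displacement.\<close>

definition energy :: "(real ^ 'd) set \<Rightarrow> 'd sfun \<times> 'd sfun \<Rightarrow> real" where
  "energy \<Omega> W = l2_inner \<Omega> (snd W) (snd W)
     + l2_inner \<Omega> (weak_grad \<Omega> (fst W)) (weak_grad \<Omega> (fst W))"

text \<open>The finite element space is abstracted to a subset \<open>V\<close> of
  \<open>H10\<close> that is closed under multiples. Chaining these balances over the subintervals
  gives conservation from the initial time on.\<close>

lemma energy_step:
  assumes sol: "fully_discrete_solution \<Omega> V A t N k \<xi> \<omega> f U0 U"
    and A: "is_discrete_laplacian \<Omega> V A" and H: "V \<subseteq> H10 \<Omega>"
    and scale: "\<And>v a. v \<in> V \<Longrightarrow> (\<lambda>x. a * v x) \<in> V"
    and mesh: "time_mesh t N T" and k: "k \<ge> 1" and gl: "gauss_lobatto k \<xi> \<omega>"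
    and f: "\<forall>s\<in>{0..T}. \<forall>x\<in>\<Omega>. f s x = 0" and n: "n \<in> {1..N}"
  shows "energy \<Omega> (U (t n)) = energy \<Omega> (U (t (n - 1)))"
proof -
  define u v where "u s = fst (U s)" and "v s = snd (U s)" for s
  have lt: "t (n - 1) < t n"
    using mesh n by (auto simp: time_mesh_def)
  have sub: "{t (n - 1)..t n} \<subseteq> {t 0..t N}"
    using time_mesh_mono[OF mesh, of 0 "n - 1"] time_mesh_mono[OF mesh, of n N] n by auto
  have sq: "square_integrable \<Omega> w" if "w \<in> V" for w
    using H that H10_square_integrable by blast
  have AV: "A w \<in> V" if "w \<in> V" for w
    using A H that by (auto simp: is_discrete_laplacian_def)
  have X: "u \<in> Xk \<Omega> t N k V" "v \<in> Xk \<Omega> t N k V"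
    using sol by (simp_all add: fully_discrete_solution_def u_def[abs_def] v_def[abs_def])
  have inV: "u s \<in> V" "v s \<in> V" if "s \<in> {t (n - 1)..t n}" for s
    using X sub that by (auto simp: Xk_def)
  obtain c where c: "\<And>j. j \<le> k \<Longrightarrow> c j \<in> V"
    and u: "\<And>s x. s \<in> subinterval t n \<Longrightarrow> u s x = (\<Sum>j\<le>k. s ^ j * c j x)"
    using X(1) n unfolding Xk_def Pk_def by blast
  obtain d where d: "\<And>j. j \<le> k \<Longrightarrow> d j \<in> V"
    and v: "\<And>s x. s \<in> subinterval t n \<Longrightarrow> v s x = (\<Sum>j\<le>k. s ^ j * d j x)"
    using X(2) n unfolding Xk_def Pk_def by blast
  have u0: "l2_inner \<Omega> (\<lambda>x. u s x - (\<Sum>j\<le>k. s ^ j * c j x)) (\<lambda>x. u s x - (\<Sum>j\<le>k. s ^ j * c j x)) = 0"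
    and v0: "l2_inner \<Omega> (\<lambda>x. v s x - (\<Sum>j\<le>k. s ^ j * d j x)) (\<lambda>x. v s x - (\<Sum>j\<le>k. s ^ j * d j x)) = 0"
    if "s \<in> {t (n - 1)..t n}" for s
    using Xk_polynomial_null_diff[OF X(1) sq lt sub c u that]
      Xk_polynomial_null_diff[OF X(2) sq lt sub d v that] by auto
  \<comment> \<open>Mass matrix of the velocity coefficients plus stiffness matrix of the
    displacement coefficients. Its quadratic form is the energy on the whole closed subinterval,
    \<open>t (n - 1)\<close> included.\<close>
  define M where "M = (\<lambda>i j. l2_inner \<Omega> (d i) (d j) + l2_inner \<Omega> (A (c i)) (c j))"
  have energy: "energy \<Omega> (U s) = quadform k M s" if s: "s \<in> {t (n - 1)..t n}" for s
    using l2_inner_self_polynomial[OF sq[OF inV(2)[OF s]] sq[OF d] v0[OF s]]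
      dirichlet_self_polynomial[OF A H inV(1)[OF s] c u0[OF s]]
    by (simp add: energy_def u_def v_def M_def quadform_add)
  define du dv where "du s = (\<lambda>x. \<Sum>j\<le>k. (of_nat j * s ^ (j - 1)) * c j x)"
    and "dv s = (\<lambda>x. \<Sum>j\<le>k. (of_nat j * s ^ (j - 1)) * d j x)" for s :: real
  have du: "local_dt t n u s = du s" and dv: "local_dt t n v s = dv s"
    if "s \<in> {t (n - 1)..t n}" for s
    unfolding du_def dv_def by (rule ext, rule local_dt_polynomial[where t = t and n = n, OF lt that],
      (erule u | erule v))+
  \<comment> \<open>The factors \<open>- 1\<close> and \<open>1\<close> are written out so that both
    components match the scaled form in \<open>polynomial_derivative_in_Pk\<close>.\<close>
  define W where "W s = ((\<lambda>x. - 1 * dv s x), (\<lambda>x. 1 * du s x))" for s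
  have "(\<lambda>s. fst (W s)) \<in> Pk (k - 1) (subinterval t n) V"
    "(\<lambda>s. snd (W s)) \<in> Pk (k - 1) (subinterval t n) V"
    unfolding W_def fst_conv snd_conv du_def dv_def
    by (intro polynomial_derivative_in_Pk k c d scale; simp)+
  then have "(LINT s:subinterval t n|lebesgue.
      l2_inner2 \<Omega> (local_dt2 t n U s) (W s) + l2_inner2 \<Omega> (wave_op A (U s)) (W s))
      = gl_quad t k \<xi> \<omega> n (\<lambda>s. l2_inner2 \<Omega> (source f s) (W s))"
    using sol n by (simp add: fully_discrete_solution_def)
  also have "\<dots> = 0"
  proof (rule gl_quad_eq_zero[where g = "\<lambda>s. l2_inner2 \<Omega> (source f s) (W s)", OF gl lt])
    fix s
    assume "t (n - 1) < s" "s < t n"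
    then have "s \<in> {0..T}"
      using sub mesh by (auto simp: time_mesh_def)
    \<comment> \<open>The source is known to vanish on \<Omega>; the indicator removes its values
      elsewhere.\<close>
    then have "(\<lambda>x. indicator \<Omega> x *\<^sub>R (f s x \<bullet> snd (W s) x)) = (\<lambda>x. 0 :: real)"
      using f by (auto simp: indicator_def)
    then have "l2_inner \<Omega> (f s) (snd (W s)) = 0"
      unfolding l2_inner_def set_lebesgue_integral_def by simp
    then show "l2_inner2 \<Omega> (source f s) (W s) = 0"
      by (simp add: l2_inner2_def source_def l2_inner_def)
  qed
  finally have zero: "(LINT s:subinterval t n|lebesgue.
      l2_inner2 \<Omega> (local_dt2 t n U s) (W s) + l2_inner2 \<Omega> (wave_op A (U s)) (W s)) = 0" .
  \<comment> \<open>Half the time derivative of the quadratic form of \<open>M\<close>. It turns out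
    to be the integrand of the tested scheme.\<close>
  define G where "G s = (\<Sum>i\<le>k. \<Sum>j\<le>k. s ^ i * (of_nat j * s ^ (j - 1)) * M i j)" for s :: real
  have "l2_inner2 \<Omega> (local_dt2 t n U s) (W s) + l2_inner2 \<Omega> (wave_op A (U s)) (W s) = G s"
    if s: "s \<in> subinterval t n" for s
  proof -
    have s': "s \<in> {t (n - 1)..t n}"
      using s by auto
    have neg: "l2_inner \<Omega> w (\<lambda>x. - z x) = - l2_inner \<Omega> w z" for w z :: "'a sfun"
      using l2_inner_scaleR[of \<Omega> 1 w "-1" z] by simp
    have neg2: "l2_inner \<Omega> (- w) z = - l2_inner \<Omega> w z" for w z :: "'a sfun"
      using l2_inner_scaleR[of \<Omega> "-1" w 1 z] by (simp add: fun_Compl_def)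
    have "l2_inner \<Omega> (v s) (dv s) = (\<Sum>j\<le>k. (of_nat j * s ^ (j - 1)) * l2_inner \<Omega> (v s) (d j))"
      using l2_inner_sum_right[of "{..k}" \<Omega> "v s" d "\<lambda>j. of_nat j * s ^ (j - 1)"]
        d sq inV(2)[OF s'] by (simp add: dv_def)
    also have "\<dots> = (\<Sum>j\<le>k. (of_nat j * s ^ (j - 1)) * (\<Sum>i\<le>k. s ^ i * l2_inner \<Omega> (d i) (d j)))"
      using l2_inner_polynomial[OF sq[OF inV(2)[OF s']] sq[OF d] v0[OF s'] sq[OF d]]
      by (intro sum.cong refl) (simp add: l2_inner_commute)
    finally have 1: "l2_inner \<Omega> (v s) (dv s)
        = (\<Sum>j\<le>k. (of_nat j * s ^ (j - 1)) * (\<Sum>i\<le>k. s ^ i * l2_inner \<Omega> (d i) (d j)))" .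
    have "l2_inner \<Omega> (A (u s)) (du s) = (\<Sum>j\<le>k. (of_nat j * s ^ (j - 1)) * l2_inner \<Omega> (A (u s)) (c j))"
      using l2_inner_sum_right[of "{..k}" \<Omega> "A (u s)" c "\<lambda>j. of_nat j * s ^ (j - 1)"]
        c sq AV inV(1)[OF s'] by (simp add: du_def)
    \<comment> \<open>Symmetry moves \<open>u s\<close> from under \<open>A\<close> into a plain L2
      argument, where its expansion in powers of \<open>s\<close> applies.\<close>
    also have "\<dots> = (\<Sum>j\<le>k. (of_nat j * s ^ (j - 1)) * (\<Sum>i\<le>k. s ^ i * l2_inner \<Omega> (A (c j)) (c i)))"
      using l2_inner_polynomial[OF sq[OF inV(1)[OF s']] sq[OF c] u0[OF s'] sq[OF AV[OF c]]]
        discrete_laplacian_symmetric[OF A H inV(1)[OF s'] c]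
      by (intro sum.cong refl) simp
    also have "\<dots> = (\<Sum>j\<le>k. (of_nat j * s ^ (j - 1)) * (\<Sum>i\<le>k. s ^ i * l2_inner \<Omega> (A (c i)) (c j)))"
      using discrete_laplacian_symmetric[OF A H c c]
      by (intro sum.cong refl arg_cong2[where f = "(*)"]) auto
    finally have 2: "l2_inner \<Omega> (A (u s)) (du s)
        = (\<Sum>j\<le>k. (of_nat j * s ^ (j - 1)) * (\<Sum>i\<le>k. s ^ i * l2_inner \<Omega> (A (c i)) (c j)))" .
    \<comment> \<open>The two pairings of \<open>du\<close> with \<open>dv\<close> enter with
      opposite signs and cancel; the minus signs in front of \<open>v\<close> and \<open>dv\<close>
      combine to a plus.\<close>
    have "l2_inner2 \<Omega> (local_dt2 t n U s) (W s) + l2_inner2 \<Omega> (wave_op A (U s)) (W s)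
        = l2_inner \<Omega> (v s) (dv s) + l2_inner \<Omega> (A (u s)) (du s)"
      using du[OF s'] dv[OF s'] l2_inner_commute[of \<Omega> "du s" "dv s"]
      by (simp add: l2_inner2_def local_dt2_def wave_op_def W_def neg neg2
          u_def[abs_def] v_def[abs_def])
    also have "\<dots> = (\<Sum>j\<le>k. \<Sum>i\<le>k. s ^ i * (of_nat j * s ^ (j - 1)) * M i j)"
      unfolding 1 2 M_def by (simp add: sum_distrib_left distrib_left sum.distrib mult_ac)
    also have "\<dots> = G s"
      unfolding G_def by (rule sum.swap)
    finally show ?thesis .
  qed
  then have "(LINT s:subinterval t n|lebesgue. G s) = 0"
    using zero by (subst set_lebesgue_integral_cong[where g = "\<lambda>s.
        l2_inner2 \<Omega> (local_dt2 t n U s) (W s) + l2_inner2 \<Omega> (wave_op A (U s)) (W s)"]) auto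
  then have "(LINT s:subinterval t n|lebesgue. 2 * G s) = 0"
    by simp
  moreover have "(LINT s:subinterval t n|lebesgue. 2 * G s)
      = quadform k M (t n) - quadform k M (t (n - 1))"
  proof (rule set_lebesgue_integral_derivative)
    fix s
    have "M i j = M j i" if "i \<le> k" "j \<le> k" for i j
      using discrete_laplacian_symmetric[OF A H c c] that by (simp add: M_def l2_inner_commute)
    then show "(quadform k M has_real_derivative 2 * G s) (at s within {t (n - 1)..t n})"
      unfolding G_def by (rule quadform_has_derivative)
  next
    show "continuous_on {t (n - 1)..t n} (\<lambda>s. 2 * G s)"
      unfolding G_def by (intro continuous_intros)
  qed (use lt in simp)
  ultimately show ?thesis
    using energy[of "t n"] energy[of "t (n - 1)"] lt by simp
qed

theorem lemma6p1:
  fixes \<Omega> :: "(real ^ 'd) set"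
    and \<T> :: "(real ^ 'd) set set"
    and \<Phi> :: "(real ^ 'd) set \<Rightarrow> real ^ 'd \<Rightarrow> real ^ 'd"
    and \<sigma> T :: real
    and r k N :: nat
    and t \<xi> \<omega> :: "nat \<Rightarrow> real"
    and Ph Ah :: "'d sfun \<Rightarrow> 'd sfun"
    and f :: "real \<Rightarrow> 'd sfun"
    and u0h u1h :: "'d sfun"
    and U LU :: "real \<Rightarrow> 'd sfun \<times> 'd sfun"
    and \<theta> :: "nat \<Rightarrow> real poly"
  defines "Vh \<equiv> fe_space \<Omega> \<T> \<Phi> r"
  assumes "CARD('d) \<in> {2, 3}"
    and "polyhedral_domain \<Omega>"
    and "quad_hex_mesh \<Omega> \<T> \<Phi>" and "shape_regular \<sigma> \<T> \<Phi>"
    and "T > 0" and "time_mesh t N T"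
    and "k \<ge> 1" and "gauss_lobatto k \<xi> \<omega>"
    and "is_l2_projection \<Omega> Vh Ph" and "is_discrete_laplacian \<Omega> Vh Ah"
    and "\<forall>s\<in>{0..T}. \<forall>x\<in>\<Omega>. f s x = 0"
    and "u0h \<in> Vh" and "u1h \<in> Vh"
    and "fully_discrete_solution \<Omega> Vh Ah t N k \<xi> \<omega> f (u0h, u1h) U"
    and "\<forall>n\<in>{1..N}. is_lifting_poly t k \<xi> n (\<theta> n)"
    and "LU = lifted_solution t N \<theta> (lift_init_dt Ph Ah f (u0h, u1h)) U"
  shows "\<forall>W\<in>{U, LU}. \<forall>n\<in>{1..N}.
    l2_inner \<Omega> (snd (W (t n))) (snd (W (t n)))
      + l2_inner \<Omega> (weak_grad \<Omega> (fst (W (t n)))) (weak_grad \<Omega> (fst (W (t n))))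
    = l2_inner \<Omega> u1h u1h + l2_inner \<Omega> (weak_grad \<Omega> u0h) (weak_grad \<Omega> u0h)"
proof -
  \<comment> \<open>The case \<open>n = 0\<close> is included to start the induction:
    \<open>t 0 = 0\<close>, and \<open>U 0\<close> is the prescribed initial value.\<close>
  have "energy \<Omega> (U (t n)) = energy \<Omega> (u0h, u1h)" if "n \<le> N" for n
    using that
  proof (induction n)
    case 0
    then show ?case
      using assms by (simp add: time_mesh_def fully_discrete_solution_def)
  next
    case (Suc n)
    then show ?case
      using energy_step[of \<Omega> Vh Ah t N k \<xi> \<omega> f "(u0h, u1h)" U T "Suc n"] assms
      by (simp add: Vh_def fe_space_scale fe_space_subset_H10)
  qed
  moreover have "LU (t n) = U (t n)" if "n \<in> {1..N}" for n
    using lifted_solution_at_mesh_point assms that by blast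
  ultimately show ?thesis
    by (auto simp: energy_def)
qed

end
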